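(* Let $a,b$ be real numbers with $0<a\leq b$, and let $\Omega=\{(x,y)\in\mathbb{R}^2 : a+b\leq x\leq y\}$. For $(x,y)\in\Omega$ define $$h(x,y)=\frac{\Gamma(x+1)\,\Gamma(x-a-b+1)}{\Gamma(x-a+1)\,\Gamma(x-b+1)}\cdot\frac{\Gamma(y-a+1)\,\Gamma(y-b+1)}{\Gamma(y+1)\,\Gamma(y-a-b+1)}.$$ Then $h(x,y)\geq 1$ for all $(x,y)\in\Omega$.
   Context: $\Gamma(x)=\int_0^\infty e^{-t}t^{x-1}\,dt$ for $x>0$ is the gamma function. *)

theory Defs
  imports "HOL-Analysis.Gamma_Function"
begin

definition Omega :: "real \<Rightarrow> real \<Rightarrow> (real \<times> real) set" where
  "Omega a b = {(x, y). a + b \<le> x \<and> x \<le> y}"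

(* On Omega a b with 0 < a \<le> b every argument of Gamma is at least 1, so no poles
   and no division by zero occur. *)
definition h :: "real \<Rightarrow> real \<Rightarrow> real \<Rightarrow> real \<Rightarrow> real" where
  "h a b x y =
     (Gamma (x + 1) * Gamma (x - a - b + 1)) / (Gamma (x - a + 1) * Gamma (x - b + 1)) *
     ((Gamma (y - a + 1) * Gamma (y - b + 1)) / (Gamma (y + 1) * Gamma (y - a - b + 1)))"

end

theory Submission
  imports Defs
begin

text \<open>
  Taking logarithms, the claim says that
  $\ln\Gamma(t+1) + \ln\Gamma(t-a-b+1) - \ln\Gamma(t-a+1) - \ln\Gamma(t-b+1)$ is decreasing in $t$.
  Its derivative is a second difference of the digamma function with steps $a$ and $b$,
  which is nonpositive because the trigamma function is decreasing.
\<close>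

text \<open>The derivative in \<open>t\<close> is the increment of trigamma over a step
  \<open>b\<close>, which is nonpositive.\<close>

lemma Digamma_real_diff_antimono:
  fixes s t b :: real
  assumes "0 < s" "s \<le> t" "0 \<le> b"
  shows "Digamma (t + b) - Digamma t \<le> Digamma (s + b) - Digamma s"
proof (rule DERIV_nonpos_imp_nonincreasing[OF \<open>s \<le> t\<close>])
  fix u assume u: "s \<le> u" "u \<le> t"
  have "((\<lambda>u. Digamma (u + b) - Digamma u) has_real_derivative
          Polygamma 1 (u + b) - Polygamma 1 u) (at u)"
    using u assms by (auto intro!: derivative_eq_intros elim!: nonpos_Ints_cases)
  moreover have "Polygamma 1 (u + b) \<le> Polygamma 1 u"
    \<comment> \<open>Strict antitonicity needs \<open>u < u + b\<close>, so \<open>b = 0\<close> is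
      split off.\<close>
    using Polygamma_real_strict_antimono[of u "u + b" 1] u assms by (cases "b = 0") auto
  ultimately show "\<exists>d. ((\<lambda>u. Digamma (u + b) - Digamma u) has_real_derivative d) (at u) \<and> d \<le> 0"
    by force
qed

lemma ln_Gamma_real_second_diff_antimono:
  fixes s t a b :: real
  assumes "0 < s" "s \<le> t" "0 \<le> a" "0 \<le> b"
  shows "ln_Gamma (t + a + b) + ln_Gamma t - ln_Gamma (t + a) - ln_Gamma (t + b)
       \<le> ln_Gamma (s + a + b) + ln_Gamma s - ln_Gamma (s + a) - ln_Gamma (s + b)"
proof (rule DERIV_nonpos_imp_nonincreasing[OF \<open>s \<le> t\<close>])
  fix u assume u: "s \<le> u" "u \<le> t"
  let ?F = "\<lambda>u. ln_Gamma (u + a + b) + ln_Gamma u - ln_Gamma (u + a) - ln_Gamma (u + b)"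
  have "(?F has_real_derivative
          Digamma (u + a + b) + Digamma u - Digamma (u + a) - Digamma (u + b)) (at u)"
    using u assms by (auto intro!: derivative_eq_intros)
  \<comment> \<open>Both sides are digamma increments over a step \<open>b\<close>, based at
    \<open>u + a\<close> and at \<open>u\<close>.\<close>
  moreover have "Digamma (u + a + b) - Digamma (u + a) \<le> Digamma (u + b) - Digamma u"
    using u assms by (intro Digamma_real_diff_antimono) auto
  ultimately show "\<exists>d. (?F has_real_derivative d) (at u) \<and> d \<le> 0"
    by force
qed

theorem theorem3p1:
  fixes a b :: real
  assumes "0 < a" and "a \<le> b"
  shows "\<forall>(x, y) \<in> Omega a b. h a b x y \<ge> 1"
proof clarify
  fix x y assume "(x, y) \<in> Omega a b"
  then have xy: "a + b \<le> x" "x \<le> y"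
    by (auto simp: Omega_def)
  \<comment> \<open>\<open>F x\<close> is the logarithm of the first factor of \<open>h\<close>; the
    second factor is \<open>exp (- F y)\<close>.\<close>
  define F where "F t = ln_Gamma (t + 1) + ln_Gamma (t - a - b + 1)
                        - ln_Gamma (t - a + 1) - ln_Gamma (t - b + 1)" for t
  have "F y \<le> F x"
    \<comment> \<open>The smallest Gamma argument serves as base point; it is at least 1 since
      \<open>a + b \<le> x\<close>. Adding \<open>a\<close>, \<open>b\<close> or both gives the
      other three.\<close>
    using ln_Gamma_real_second_diff_antimono[of "x - a - b + 1" "y - a - b + 1" a b] assms xy
    by (simp add: F_def algebra_simps)
  moreover have "h a b x y = exp (F x - F y)"
    using assms xy
    by (simp add: h_def F_def Gamma_real_pos_exp exp_diff exp_add)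
  ultimately show "1 \<le> h a b x y"
    by simp
qed

end
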